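(* For every nonzero $A\in\mathbb S^d$ one has $0\le\mathcal I_\Pi(A)\le1$. Moreover, $$\rho_\Pi=\max_{A\in\mathbb S^d,\ A\ne0}\mathcal I_\Pi(A).$$ If $A=UU^\top\neq 0$ for some $U\in\mathbb R^{d\times m}$, then $$\mathcal I_\Pi(UU^\top)=\frac{\mathbb E\|U^\top P_tU\|_F^2}{\|UU^\top\|_F^2}.$$ In particular, if $E\subset\mathbb R^d$ is an $m$-dimensional subspace ($m\ge1$) and $\Pi_E$ denotes the orthogonal projector onto $E$, then $$\mathcal I_\Pi(\Pi_E)=\frac1m\,\mathbb E\|\Pi_EP_t\Pi_E\|_F^2=\frac1m\,\mathbb E\sum_{j=1}^m\cos^4\!\big(\theta_j(E,\operatorname{null}(X_t))\big),$$ where $\theta_1(E,\operatorname{null}(X_t)),\dots,\theta_m(E,\operatorname{null}(X_t))$ are the principal angles between $E$ and $\operatorname{null}(X_t)$.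
   Context: A task is a pair $(X,y)$ with $X\in\mathbb R^{n\times d}$, $y\in\mathbb R^n$ ($n\ge1$ may depend on the task) and $\operatorname{rank}(X)<d$. $\Pi$ is a probability distribution on tasks, and $(X_t,y_t)$, $t\ge1$, are i.i.d. from $\Pi$. $P_t:=I-X_t^+X_t$ ($X^+$ the Moore–Penrose pseudoinverse) is the orthogonal projector onto $\operatorname{null}(X_t)$. $\mathbb S^d$ is the space of symmetric $d\times d$ real matrices with the Frobenius inner product; $S_\Pi:\mathbb S^d\to\mathbb S^d$, $S_\Pi(A):=\mathbb E[P_tAP_t]$ (independent of $t$); $\rho_\Pi:=\|S_\Pi\|_{\mathrm{op},F}$ is the operator norm of $S_\Pi$ with respect to the Frobenius norm. For nonzero $A\in\mathbb S^d$, $$\mathcal I_\Pi(A):=\frac{\mathbb E\|P_tAP_t\|_F^2}{\|A\|_F^2}.$$ Convention on principal angles between an $m$-dimensional subspace $E$ and a subspace $N$: there are $m$ angles $\theta_j\in[0,\pi/2]$ whose cosines are the $m$ singular values of the restriction to $E$ of the orthogonal projector onto $N$ (so if $\dim N<m$ the missing angles are taken equal to $\pi/2$). *)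

theory Defs
  imports "HOL-Probability.Probability"
begin

section \<open>Moore--Penrose pseudoinverse\<close>

(* The number n of rows of X varies with the task, so X cannot be an element of a fixed matrix
   type real ^ 'd ^ 'n.  Matrices with row or column index in {..<n} are written as functions;
   K is the range of the summation index of a matrix product. *)
definition mat_mult_on :: "'k set \<Rightarrow> ('i \<Rightarrow> 'k \<Rightarrow> real) \<Rightarrow> ('k \<Rightarrow> 'j \<Rightarrow> real) \<Rightarrow> 'i \<Rightarrow> 'j \<Rightarrow> real" where
  "mat_mult_on K A B i j = (\<Sum>k\<in>K. A i k * B k j)"

(* The four Penrose conditions for Y being the pseudoinverse of the I x J matrix X. *)
definition is_pseudoinverse_on ::
    "'i set \<Rightarrow> 'j set \<Rightarrow> ('i \<Rightarrow> 'j \<Rightarrow> real) \<Rightarrow> ('j \<Rightarrow> 'i \<Rightarrow> real) \<Rightarrow> bool" where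
  "is_pseudoinverse_on I J X Y \<longleftrightarrow>
     (\<forall>i\<in>I. \<forall>j\<in>J. mat_mult_on I (mat_mult_on J X Y) X i j = X i j) \<and>
     (\<forall>j\<in>J. \<forall>i\<in>I. mat_mult_on J (mat_mult_on I Y X) Y j i = Y j i) \<and>
     (\<forall>i\<in>I. \<forall>i'\<in>I. mat_mult_on J X Y i i' = mat_mult_on J X Y i' i) \<and>
     (\<forall>j\<in>J. \<forall>j'\<in>J. mat_mult_on I Y X j j' = mat_mult_on I Y X j' j)"

(* Entries outside J x I are normalised to 0, which makes the pseudoinverse unique as a function. *)
definition pseudoinverse_on :: "'i set \<Rightarrow> 'j set \<Rightarrow> ('i \<Rightarrow> 'j \<Rightarrow> real) \<Rightarrow> 'j \<Rightarrow> 'i \<Rightarrow> real" where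
  "pseudoinverse_on I J X =
     (THE Y. is_pseudoinverse_on I J X Y \<and> (\<forall>j i. j \<notin> J \<or> i \<notin> I \<longrightarrow> Y j i = 0))"


section \<open>Tasks\<close>

(* (n, X, y): for i < n, X i is the i-th row of the n x d matrix X and y i the i-th label; both are
   padded with 0 for i >= n, so that a task corresponds to exactly one such triple. *)
type_synonym 'd task = "nat \<times> (nat \<Rightarrow> real ^ 'd) \<times> (nat \<Rightarrow> real)"

(* As for the library's rank, dim of the set of rows. *)
definition tasks :: "'d::finite task set" where
  "tasks = {(n, X, y). n \<ge> 1 \<and> (\<forall>i\<ge>n. X i = 0 \<and> y i = 0) \<and> dim (X ` {..<n}) < CARD('d)}"

(* nat is discrete and the function spaces carry the product topology, so on the padded triples
   this is the Borel sigma-algebra of the disjoint union over n of R^(n x d) x R^n,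
   restricted to rank X < d. *)
definition task_space :: "'d::finite task measure" where
  "task_space = restrict_space borel tasks"

definition task_distribution :: "'d::finite task measure \<Rightarrow> bool" where
  "task_distribution \<mu> \<longleftrightarrow> prob_space \<mu> \<and> sets \<mu> = sets task_space"

definition iid_tasks ::
    "'w measure \<Rightarrow> (nat \<Rightarrow> 'w \<Rightarrow> 'd::finite task) \<Rightarrow> 'd task measure \<Rightarrow> bool" where
  "iid_tasks M T \<mu> \<longleftrightarrow> prob_space M \<and>
     prob_space.indep_vars M (\<lambda>_. task_space) T {1..} \<and>
     (\<forall>t\<ge>1. distr M task_space (T t) = \<mu>)"

fun task_null :: "'d::finite task \<Rightarrow> (real ^ 'd) set" where
  "task_null (n, X, y) = {v. \<forall>i<n. X i \<bullet> v = 0}"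

(* P = I - X^+ X *)
fun task_proj :: "'d::finite task \<Rightarrow> real ^ 'd ^ 'd" where
  "task_proj (n, X, y) = mat 1 -
     (\<chi> i j. mat_mult_on {..<n} (pseudoinverse_on {..<n} UNIV (\<lambda>i j. X i $ j)) (\<lambda>i j. X i $ j) i j)"


section \<open>The operator S, its norm, and the interference ratio\<close>

(* The library's inner product and norm on real ^ 'd ^ 'd are the Frobenius ones. *)
definition sym_mats :: "(real ^ 'd ^ 'd) set" where
  "sym_mats = {A. transpose A = A}"

definition S_op :: "'d::finite task measure \<Rightarrow> real ^ 'd ^ 'd \<Rightarrow> real ^ 'd ^ 'd" where
  "S_op \<mu> A = (\<integral>\<tau>. task_proj \<tau> ** A ** task_proj \<tau> \<partial>\<mu>)"

(* The library's onorm, relative to a subspace V; the quotient is 0 at x = 0. *)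
definition onorm_on :: "'a::real_normed_vector set \<Rightarrow> ('a \<Rightarrow> 'b::real_normed_vector) \<Rightarrow> real" where
  "onorm_on V f = (SUP x\<in>V. norm (f x) / norm x)"

definition rho :: "'d::finite task measure \<Rightarrow> real" where
  "rho \<mu> = onorm_on sym_mats (S_op \<mu>)"

definition I_ratio :: "'d::finite task measure \<Rightarrow> real ^ 'd ^ 'd \<Rightarrow> real" where
  "I_ratio \<mu> A = (\<integral>\<tau>. (norm (task_proj \<tau> ** A ** task_proj \<tau>))\<^sup>2 \<partial>\<mu>) / (norm A)\<^sup>2"


section \<open>Orthogonal projectors and principal angles\<close>

definition orth_proj :: "'a::euclidean_space set \<Rightarrow> 'a \<Rightarrow> 'a" where
  "orth_proj V x = (THE p. p \<in> V \<and> x - p \<in> V\<^sup>\<bottom>)"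

definition orth_proj_mat :: "(real ^ 'd) set \<Rightarrow> real ^ 'd ^ 'd::finite" where
  "orth_proj_mat V = matrix (orth_proj V)"

(* Singular values of the restriction of f to the subspace E, in decreasing order: the square roots
   of the eigenvalues, with multiplicity, of g* g for g = f restricted to E.  The adjoint of g is
   the adjoint of f followed by the orthogonal projection onto E. *)
definition singular_values_on ::
    "'a::euclidean_space set \<Rightarrow> ('a \<Rightarrow> 'b::euclidean_space) \<Rightarrow> real list" where
  "singular_values_on E f = (THE \<sigma>. sorted_wrt (\<ge>) \<sigma> \<and>
     (\<forall>s. count_list \<sigma> s =
        (if s \<ge> 0 then dim {x\<in>E. orth_proj E (adjoint f (f x)) = s\<^sup>2 *\<^sub>R x} else 0)))"

(* Indices j = 1, ..., dim E, whatever the dimension of N. *)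
definition principal_angle :: "'a::euclidean_space set \<Rightarrow> 'a set \<Rightarrow> nat \<Rightarrow> real" where
  "principal_angle E N j = arccos (singular_values_on E (orth_proj N) ! (j - 1))"

end

theory Submission
  imports Defs
begin

(* S is self-adjoint and positive semidefinite for the Frobenius inner product, because
   <A, PAP> = |PAP|^2 for every orthogonal projector P.  Hence the interference ratio of A is the
   Rayleigh quotient <A, S A> / |A|^2, whose maximum is the operator norm by the Cauchy-Schwarz
   inequality for the form <A, S B>.  Cyclicity of the trace turns |P U U^T P| into |U^T P U|.
   For U = Pi_E, diagonalise Pi_E P Pi_E in an orthonormal basis of E: its eigenvalues are the
   squared cosines of the principal angles. *)


section \<open>Orthogonal projections\<close>

text \<open>The expectations are meaningful only if \<open>task_proj\<close> is Borel, and this is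
  the main obstacle: the projector jumps wherever the rank of X does, and it is given by a
  description operator through the Penrose conditions. It is therefore identified twice, with the
  orthogonal projector onto the null space for the algebra and with a Gram-Schmidt recursion for
  measurability. The spectral arguments are relative to a subspace V. One reason is that S is normed
  on symmetric matrices only; another is that Pi_E Pi_N is self-adjoint on E, but in general not on
  the whole space. The inequality behind the norm formula also produces the eigenvectors. Singular
  values are specified by multiplicities, so they are found as a multiset, by counting vectors of an
  orthonormal eigenbasis.\<close>

lemma orth_proj_eqI:
  fixes V :: "'a::euclidean_space set"
  assumes V: "subspace V" and p: "p \<in> V" "x - p \<in> V\<^sup>\<bottom>"
  shows "orth_proj V x = p"
  unfolding orth_proj_def
proof (rule the_equality)
  fix q assume q: "q \<in> V \<and> x - q \<in> V\<^sup>\<bottom>"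
  have "p - q \<in> V"
    using V p(1) q by (simp add: subspace_diff)
  moreover have "p - q \<in> V\<^sup>\<bottom>"
    using subspace_diff[OF subspace_orthogonal_comp, of "x - q" V "x - p"] p q by simp
  ultimately have "(p - q) \<bullet> (p - q) = 0"
    by (auto simp: orthogonal_comp_def orthogonal_def)
  then show "q = p" by simp
qed (use p in simp)

lemma
  fixes V :: "'a::euclidean_space set"
  assumes V: "subspace V"
  shows orth_proj_in: "orth_proj V x \<in> V"
    and orth_proj_diff_in: "x - orth_proj V x \<in> V\<^sup>\<bottom>"
proof -
  obtain y z where yz: "y \<in> span V" "\<And>w. w \<in> span V \<Longrightarrow> orthogonal z w" "x = y + z"
    using orthogonal_subspace_decomp_exists[of V x] by metis
  have y: "y \<in> V" "x - y \<in> V\<^sup>\<bottom>"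
    using yz V by (auto simp: orthogonal_comp_def span_eq_iff[THEN iffD2] orthogonal_commute)
  then have "orth_proj V x = y"
    by (rule orth_proj_eqI[OF V])
  then show "orth_proj V x \<in> V" "x - orth_proj V x \<in> V\<^sup>\<bottom>"
    using y by auto
qed

lemma orth_proj_id:
  fixes V :: "'a::euclidean_space set"
  assumes "subspace V" "x \<in> V"
  shows "orth_proj V x = x"
  using assms by (intro orth_proj_eqI) (auto simp: orthogonal_comp_def orthogonal_def)

lemma orth_proj_zero:
  fixes V :: "'a::euclidean_space set"
  assumes "subspace V" "x \<in> V\<^sup>\<bottom>"
  shows "orth_proj V x = 0"
  using assms by (intro orth_proj_eqI) (auto simp: subspace_0)

lemma linear_orth_proj:
  fixes V :: "'a::euclidean_space set"
  assumes V: "subspace V"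
  shows "linear (orth_proj V)"
proof (rule linearI)
  fix x y :: 'a and c :: real
  have "(x - orth_proj V x) + (y - orth_proj V y) \<in> V\<^sup>\<bottom>"
    by (intro subspace_add subspace_orthogonal_comp orth_proj_diff_in V)
  then show "orth_proj V (x + y) = orth_proj V x + orth_proj V y"
    by (intro orth_proj_eqI V subspace_add orth_proj_in) (simp_all add: algebra_simps)
  have "c *\<^sub>R (x - orth_proj V x) \<in> V\<^sup>\<bottom>"
    by (intro subspace_scale subspace_orthogonal_comp orth_proj_diff_in V)
  then show "orth_proj V (c *\<^sub>R x) = c *\<^sub>R orth_proj V x"
    by (intro orth_proj_eqI V subspace_scale orth_proj_in) (simp_all add: algebra_simps)
qed

lemma orth_proj_inner:
  fixes V :: "'a::euclidean_space set"
  assumes V: "subspace V"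
  shows "x \<bullet> orth_proj V y = orth_proj V x \<bullet> orth_proj V y"
  using orth_proj_in[OF V, of y] orth_proj_diff_in[OF V, of x]
  by (auto simp: orthogonal_comp_def orthogonal_def inner_diff_right inner_commute)

lemma orth_proj_selfadjoint:
  fixes V :: "'a::euclidean_space set"
  assumes V: "subspace V"
  shows "orth_proj V x \<bullet> y = x \<bullet> orth_proj V y"
  by (metis orth_proj_inner[OF V] inner_commute)

lemma adjoint_orth_proj:
  fixes V :: "'a::euclidean_space set"
  assumes "subspace V"
  shows "adjoint (orth_proj V) = orth_proj V"
  by (intro adjoint_unique allI orth_proj_selfadjoint[OF assms, symmetric]
      orth_proj_selfadjoint[OF assms])

lemma norm_orth_proj_le:
  fixes V :: "'a::euclidean_space set"
  assumes V: "subspace V"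
  shows "norm (orth_proj V x) \<le> norm x"
proof (cases "orth_proj V x = 0")
  case False
  have "norm (orth_proj V x) * norm (orth_proj V x) \<le> norm x * norm (orth_proj V x)"
    using norm_cauchy_schwarz[of x "orth_proj V x"] orth_proj_inner[OF V, of x x]
    by (simp add: norm_eq_sqrt_inner)
  with False show ?thesis by simp
qed simp

lemma orth_proj_mat_mult:
  assumes "subspace V"
  shows "orth_proj_mat V *v x = orth_proj V x"
  unfolding orth_proj_mat_def by (rule matrix_works) (simp add: linear_orth_proj[OF assms] linear_matrix_vector_mul_eq)

lemma transpose_orth_proj_mat:
  assumes "subspace V"
  shows "transpose (orth_proj_mat V) = orth_proj_mat V"
  unfolding orth_proj_mat_def
  using matrix_adjoint[OF linear_orth_proj[OF assms]] adjoint_orth_proj[OF assms] by simp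

lemma orth_proj_mat_idem:
  assumes "subspace V"
  shows "orth_proj_mat V ** orth_proj_mat V = orth_proj_mat V"
  unfolding matrix_eq
  by (simp add: matrix_vector_mul_assoc[symmetric] orth_proj_mat_mult assms orth_proj_id orth_proj_in)

lemma orth_proj_mat_eqI:
  assumes "subspace V" "\<And>x. P *v x \<in> V" "\<And>x. x - P *v x \<in> V\<^sup>\<bottom>"
  shows "orth_proj_mat V = P"
  unfolding matrix_eq using assms by (simp add: orth_proj_mat_mult orth_proj_eqI)


section \<open>Self-adjoint operators on a subspace\<close>

text \<open>The form at x + t y is the quadratic a + 2 t b + t^2 c, nonnegative for all real t. The
  form need not be definite, so c = 0 is a case of its own; the eigenvector argument below rests on
  exactly that degenerate case.\<close>

lemma psd_form_Cauchy_Schwarz: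
  fixes f :: "'a::real_inner \<Rightarrow> 'a"
  assumes f: "linear f" and V: "subspace V"
    and sa: "\<And>x y. x \<in> V \<Longrightarrow> y \<in> V \<Longrightarrow> f x \<bullet> y = x \<bullet> f y"
    and psd: "\<And>x. x \<in> V \<Longrightarrow> 0 \<le> x \<bullet> f x"
    and xy: "x \<in> V" "y \<in> V"
  shows "(x \<bullet> f y)\<^sup>2 \<le> (x \<bullet> f x) * (y \<bullet> f y)"
proof -
  define a b c where "a = x \<bullet> f x" and "b = x \<bullet> f y" and "c = y \<bullet> f y"
  have yx: "y \<bullet> f x = b"
    using sa[OF xy] by (simp add: b_def inner_commute)
  have q: "0 \<le> a + 2 * t * b + t\<^sup>2 * c" for t
  proof -
    have "x + t *\<^sub>R y \<in> V"
      using V xy by (simp add: subspace_add subspace_scale)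
    from psd[OF this] show ?thesis
      using yx by (simp add: linear_add[OF f] linear_scale[OF f] inner_add_left inner_add_right
          a_def b_def c_def power2_eq_square algebra_simps)
  qed
  have c: "0 \<le> c" using psd xy by (simp add: c_def)
  show ?thesis
  proof (cases "c = 0")
    case True
    have "b = 0"
    proof (rule ccontr)
      assume "b \<noteq> 0"
      \<comment> \<open>With c = 0 the quadratic is affine in t, and this t gives it the value
        -1.\<close>
      with q[of "- (a + 1) / (2 * b)"] True show False by (simp add: field_simps)
    qed
    then show ?thesis using True by (simp add: a_def b_def c_def)
  next
    case False
    with c have "0 < c" by simp
    \<comment> \<open>The minimum of the quadratic, with value a - b^2 / c.\<close>
    with q[of "- b / c"] have "b\<^sup>2 \<le> a * c"
      by (simp add: power2_eq_square field_simps)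
    then show ?thesis by (simp add: a_def b_def c_def)
  qed
qed

lemma rayleigh_maximizer:
  fixes f :: "'a::euclidean_space \<Rightarrow> 'a"
  assumes f: "linear f" and V: "subspace V" and ne: "V \<noteq> {0}"
  obtains x where "x \<in> V" "norm x = 1" "\<And>y. y \<in> V \<Longrightarrow> y \<bullet> f y \<le> (x \<bullet> f x) * (norm y)\<^sup>2"
proof -
  let ?K = "V \<inter> sphere 0 1"
  obtain v where v: "v \<in> V" "v \<noteq> 0"
    using ne subspace_0[OF V] by blast
  have "v /\<^sub>R norm v \<in> ?K"
    using v V by (simp add: subspace_scale)
  moreover have "compact ?K"
    using closed_subspace[OF V] by (simp add: closed_Int_compact)
  moreover have "continuous_on ?K (\<lambda>x. x \<bullet> f x)"
    by (intro continuous_intros linear_continuous_on) (simp add: f linear_conv_bounded_linear[symmetric])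
  ultimately obtain x where x: "x \<in> ?K" "\<And>y. y \<in> ?K \<Longrightarrow> y \<bullet> f y \<le> x \<bullet> f x"
    using continuous_attains_sup[of ?K "\<lambda>x. x \<bullet> f x"] by blast
  have "y \<bullet> f y \<le> (x \<bullet> f x) * (norm y)\<^sup>2" if y: "y \<in> V" for y
  proof (cases "y = 0")
    case False
    have "y /\<^sub>R norm y \<in> ?K"
      using y V False by (simp add: subspace_scale)
    from x(2)[OF this] show ?thesis
      using False by (simp add: linear_scale[OF f] field_simps power2_eq_square)
  qed (simp add: linear_0[OF f])
  with x(1) show ?thesis by (intro that[of x]) auto
qed

text \<open>Let c be the maximal Rayleigh quotient. Cauchy-Schwarz for the form, applied to f y and
  y, gives |f y|^4 \<le> (c |f y|^2) (c |y|^2), hence |f y| \<le> c |y|; invariance of V lets c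
  bound the form at f y as well. Conversely c = x . f x \<le> |f x| at the unit maximizer x.\<close>

lemma rayleigh_max_eq_onorm_on:
  fixes f :: "'a::euclidean_space \<Rightarrow> 'a"
  assumes f: "linear f" and V: "subspace V" "V \<noteq> {0}" and fV: "f ` V \<subseteq> V"
    and sa: "\<And>x y. x \<in> V \<Longrightarrow> y \<in> V \<Longrightarrow> f x \<bullet> y = x \<bullet> f y"
    and psd: "\<And>x. x \<in> V \<Longrightarrow> 0 \<le> x \<bullet> f x"
  shows "\<exists>x\<in>V. x \<noteq> 0 \<and> (x \<bullet> f x) / (norm x)\<^sup>2 = onorm_on V f"
    and "\<And>x. x \<in> V \<Longrightarrow> x \<noteq> 0 \<Longrightarrow> (x \<bullet> f x) / (norm x)\<^sup>2 \<le> onorm_on V f"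
proof -
  obtain x where x: "x \<in> V" "norm x = 1"
    and max: "\<And>y. y \<in> V \<Longrightarrow> y \<bullet> f y \<le> (x \<bullet> f x) * (norm y)\<^sup>2"
    using rayleigh_maximizer[OF f V] by metis
  define c where "c = x \<bullet> f x"
  have c0: "0 \<le> c" using psd x by (simp add: c_def)
  have bound: "norm (f y) / norm y \<le> c" if y: "y \<in> V" for y
  \<comment> \<open>The factor |f y|^2 is cancelled below, so f y = 0 is separate. That case
    includes y = 0, where the quotient is 0 / 0 = 0.\<close>
  proof (cases "f y = 0")
    case False
    have fy: "f y \<in> V" using fV y by blast
    have "(norm (f y))\<^sup>2 * (norm (f y))\<^sup>2 = (f y \<bullet> f y)\<^sup>2"
      unfolding dot_square_norm by (rule power2_eq_square[symmetric])
    also have "\<dots> \<le> (f y \<bullet> f (f y)) * (y \<bullet> f y)"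
      by (rule psd_form_Cauchy_Schwarz[OF f V(1) sa psd fy y])
    also have "\<dots> \<le> (c * (norm (f y))\<^sup>2) * (c * (norm y)\<^sup>2)"
      using max[OF fy] max[OF y] psd[OF fy] psd[OF y] c0
      by (intro mult_mono) (auto simp: c_def)
    also have "\<dots> = (norm (f y))\<^sup>2 * (c * norm y)\<^sup>2"
      by (simp add: power2_eq_square)
    finally have le: "(norm (f y))\<^sup>2 * (norm (f y))\<^sup>2 \<le> (norm (f y))\<^sup>2 * (c * norm y)\<^sup>2" .
    have "0 < (norm (f y))\<^sup>2" using False by simp
    with le have "(norm (f y))\<^sup>2 \<le> (c * norm y)\<^sup>2"
      by (simp only: mult_le_cancel_left_pos)
    then have "norm (f y) \<le> c * norm y"
      by (rule power2_le_imp_le) (use c0 in simp)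
    moreover have "y \<noteq> 0" using False linear_0[OF f] by auto
    ultimately show ?thesis by (simp add: field_simps)
  qed (use c0 in simp)
  have "c \<le> norm (f x) / norm x"
    using norm_cauchy_schwarz[of x "f x"] x(2) by (simp add: c_def)
  with bound[OF x(1)] have cx: "norm (f x) / norm x = c" by simp
  have c: "onorm_on V f = c"
    unfolding onorm_on_def
  proof (rule cSup_eq_maximum)
    show "c \<in> (\<lambda>x. norm (f x) / norm x) ` V"
      using x(1) cx by (intro image_eqI[of _ _ x]) simp_all
  qed (use bound in blast)
  show "\<exists>x\<in>V. x \<noteq> 0 \<and> (x \<bullet> f x) / (norm x)\<^sup>2 = onorm_on V f"
    unfolding c c_def using x by (intro bexI[of _ x]) auto
  show "(y \<bullet> f y) / (norm y)\<^sup>2 \<le> onorm_on V f" if "y \<in> V" "y \<noteq> 0" for y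
    unfolding c c_def using max[OF that(1)] that(2) by (simp add: pos_divide_le_eq)
qed

text \<open>With c the maximum, g = c id - f is semidefinite on V and x . g x = 0. Cauchy-Schwarz
  applied to g x and x gives |g x|^4 \<le> 0, so a maximizer is an eigenvector, without
  differentiating the Rayleigh quotient.\<close>

lemma selfadjoint_eigenvector:
  fixes f :: "'a::euclidean_space \<Rightarrow> 'a"
  assumes f: "linear f" and V: "subspace V" "V \<noteq> {0}" and fV: "f ` V \<subseteq> V"
    and sa: "\<And>x y. x \<in> V \<Longrightarrow> y \<in> V \<Longrightarrow> f x \<bullet> y = x \<bullet> f y"
  obtains x where "x \<in> V" "norm x = 1" "f x = (x \<bullet> f x) *\<^sub>R x"
proof -
  obtain x where x: "x \<in> V" "norm x = 1"
    and max: "\<And>y. y \<in> V \<Longrightarrow> y \<bullet> f y \<le> (x \<bullet> f x) * (norm y)\<^sup>2"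
    using rayleigh_maximizer[OF f V] by metis
  define g where "g y = (x \<bullet> f x) *\<^sub>R y - f y" for y
  have g: "linear g"
    unfolding g_def using f by (intro linear_compose_sub linear_compose_scale_right) (auto simp: linear_id[unfolded id_def])
  have "g x \<in> V"
    using fV x V by (auto simp: g_def intro!: subspace_diff subspace_scale)
  moreover have "x \<bullet> g x = 0"
    using x(2) by (simp add: g_def inner_diff_right dot_square_norm)
  moreover have "g u \<bullet> v = u \<bullet> g v" if "u \<in> V" "v \<in> V" for u v
    using sa[OF that] by (simp add: g_def inner_diff_left inner_diff_right)
  moreover have "0 \<le> u \<bullet> g u" if "u \<in> V" for u
    using max[OF that] by (simp add: g_def inner_diff_right dot_square_norm)
  ultimately have "(g x \<bullet> g x)\<^sup>2 \<le> 0"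
    using psd_form_Cauchy_Schwarz[OF g V(1), of "g x" x] x(1) by simp
  then have "g x = 0" by simp
  with x show ?thesis by (intro that[of x]) (auto simp: g_def)
qed

text \<open>Split off an eigenvector x; its complement W in V is invariant because f is
  self-adjoint. The operator stays the same and only V shrinks. Recording the eigenvalue as
  \<open>b \<bullet> f b\<close> avoids choosing a family of eigenvalues.\<close>

lemma selfadjoint_eigenbasis:
  fixes f :: "'a::euclidean_space \<Rightarrow> 'a"
  assumes f: "linear f" and "subspace V" and "f ` V \<subseteq> V"
    and "\<And>x y. x \<in> V \<Longrightarrow> y \<in> V \<Longrightarrow> f x \<bullet> y = x \<bullet> f y"
  shows "\<exists>B\<subseteq>V. finite B \<and> pairwise orthogonal B \<and> (\<forall>b\<in>B. norm b = 1) \<and> span B = V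
    \<and> (\<forall>b\<in>B. f b = (b \<bullet> f b) *\<^sub>R b)"
  using assms(2-)
proof (induction "dim V" arbitrary: V rule: less_induct)
  case less
  note V = less.prems(1) and fV = less.prems(2) and sa = less.prems(3)
  show ?case
  proof (cases "V = {0}")
    case False
    obtain x where x: "x \<in> V" "norm x = 1" "f x = (x \<bullet> f x) *\<^sub>R x"
      using selfadjoint_eigenvector[OF f V False fV sa] by metis
    define W where "W = {y \<in> V. x \<bullet> y = 0}"
    have W: "subspace W" "W \<subseteq> V"
      using V by (auto simp: W_def subspace_def inner_add_right)
    have "x \<notin> W" using x by (simp add: W_def dot_square_norm)
    then have "dim W < dim V"
      using W V x(1) by (metis dim_subset le_neq_implies_less subspace_dim_equal order_refl)
    moreover have "f ` W \<subseteq> W"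
    proof
      fix z assume "z \<in> f ` W"
      then obtain y where y: "z = f y" "y \<in> V" "x \<bullet> y = 0" by (auto simp: W_def)
      have "x \<bullet> f y = f x \<bullet> y" using sa[OF x(1) y(2)] by simp
      also have "\<dots> = 0" using y(3) by (subst x(3)) simp
      finally show "z \<in> W" using y fV by (auto simp: W_def)
    qed
    ultimately obtain B where B: "B \<subseteq> W" "finite B" "pairwise orthogonal B" "\<forall>b\<in>B. norm b = 1"
      "span B = W" "\<forall>b\<in>B. f b = (b \<bullet> f b) *\<^sub>R b"
      using less.hyps[of W] W sa by (metis (no_types, lifting) subsetD)
    have "span (insert x B) = V"
    proof
      show "span (insert x B) \<subseteq> V"
        using B(1) W x(1) V by (intro span_minimal) auto
      show "V \<subseteq> span (insert x B)"
      proof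
        fix y assume y: "y \<in> V"
        have "y - (x \<bullet> y) *\<^sub>R x \<in> W"
          using V x y by (auto simp: W_def inner_diff_right dot_square_norm subspace_diff subspace_scale)
        then have "y - (x \<bullet> y) *\<^sub>R x \<in> span B" using B by simp
        then show "y \<in> span (insert x B)"
          unfolding span_insert by blast
      qed
    qed
    moreover have "pairwise orthogonal (insert x B)"
      using B(1,3) by (auto simp: pairwise_insert W_def orthogonal_def inner_commute)
    ultimately show ?thesis
      using B x W by (intro exI[of _ "insert x B"]) auto
  qed (auto intro!: exI[of _ "{}"])
qed

section \<open>Multiplicities of eigenvalues\<close>

lemma orthonormal_independent:
  fixes B :: "'a::euclidean_space set"
  assumes "pairwise orthogonal B" "\<forall>b\<in>B. norm b = 1"
  shows "independent B"
  using assms by (intro pairwise_orthogonal_independent) auto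

text \<open>Comparing coefficients of f x = c x in the basis B leaves only basis vectors with
  eigenvalue c. This turns the dimensions in the definition of singular values into
  cardinalities.\<close>

lemma dim_eigenspace:
  fixes f :: "'a::euclidean_space \<Rightarrow> 'a"
  assumes f: "linear f" and B: "finite B" "pairwise orthogonal B" "\<forall>b\<in>B. norm b = 1"
    and eig: "\<And>b. b \<in> B \<Longrightarrow> f b = l b *\<^sub>R b"
  shows "dim {x \<in> span B. f x = c *\<^sub>R x} = card {b \<in> B. l b = c}"
proof -
  let ?C = "{b \<in> B. l b = c}"
  have "{x \<in> span B. f x = c *\<^sub>R x} = span ?C"
  proof
    show "span ?C \<subseteq> {x \<in> span B. f x = c *\<^sub>R x}"
    proof (rule span_minimal)
      show "?C \<subseteq> {x \<in> span B. f x = c *\<^sub>R x}"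
        using eig by (auto intro: span_base)
      show "subspace {x \<in> span B. f x = c *\<^sub>R x}"
        by (auto simp: subspace_def linear_0[OF f] linear_add[OF f] linear_scale[OF f]
            span_zero span_add span_scale algebra_simps)
    qed
    show "{x \<in> span B. f x = c *\<^sub>R x} \<subseteq> span ?C"
    proof clarify
      fix x assume x: "x \<in> span B" "f x = c *\<^sub>R x"
      have ex: "(\<Sum>b\<in>B. (x \<bullet> b) *\<^sub>R b) = x"
        using B x by (intro orthonormal_basis_expand) auto
      have "(x \<bullet> b) *\<^sub>R b \<in> span ?C" if b: "b \<in> B" for b
      proof (cases "l b = c")
        case True
        then show ?thesis using b by (intro span_scale span_base) auto
      next
        case False
        have "c *\<^sub>R x = (\<Sum>b'\<in>B. (x \<bullet> b') *\<^sub>R f b')"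
          using arg_cong[OF ex, of f] x(2) by (simp add: linear_sum[OF f] linear_scale[OF f])
        then have "c * (x \<bullet> b) = (\<Sum>b'\<in>B. (x \<bullet> b') *\<^sub>R f b') \<bullet> b"
          by (metis inner_scaleR_left)
        also have "\<dots> = (\<Sum>b'\<in>B. if b' = b then (x \<bullet> b) * l b else 0)"
          unfolding inner_sum_left using b B eig
          by (intro sum.cong) (auto simp: pairwise_def orthogonal_def dot_square_norm)
        also have "\<dots> = (x \<bullet> b) * l b" using B b by simp
        finally show ?thesis using False by (simp add: span_zero)
      qed
      then have "(\<Sum>b\<in>B. (x \<bullet> b) *\<^sub>R b) \<in> span ?C" by (rule span_sum)
      then show "x \<in> span ?C" by (simp add: ex)
    qed
  qed
  moreover have "independent ?C"
    using B by (intro orthonormal_independent) (auto simp: pairwise_def)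
  ultimately show ?thesis by (simp add: dim_eq_card_independent)
qed


section \<open>The Frobenius inner product\<close>

lemma inner_matrix_trace:
  fixes A B :: "real ^ 'n ^ 'm"
  shows "A \<bullet> B = trace (transpose A ** B)"
proof -
  have "A \<bullet> B = (\<Sum>i\<in>UNIV. \<Sum>j\<in>UNIV. A $ i $ j * B $ i $ j)"
    by (simp add: inner_vec_def)
  also have "\<dots> = (\<Sum>j\<in>UNIV. \<Sum>i\<in>UNIV. A $ i $ j * B $ i $ j)"
    by (rule sum.swap)
  finally show ?thesis
    by (simp add: trace_def matrix_matrix_mult_def transpose_def)
qed

text \<open>Cyclicity of the trace moves the outermost P to the other end, where two copies merge.
  In other words, compression by P is itself an orthogonal projection in the space of
  matrices.\<close>

lemma inner_compression:
  fixes A B P :: "real ^ 'n ^ 'n"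
  assumes P: "transpose P = P" "P ** P = P"
  shows "A \<bullet> (P ** B ** P) = (P ** A ** P) \<bullet> (P ** B ** P)"
proof -
  have "(P ** A ** P) \<bullet> (P ** B ** P) = trace (P ** (transpose A ** (P ** P) ** B ** P))"
    by (simp add: inner_matrix_trace matrix_transpose_mul P(1) matrix_mul_assoc)
  also have "\<dots> = trace (transpose A ** (P ** P) ** B ** (P ** P))"
    by (subst trace_mul_sym) (simp add: matrix_mul_assoc)
  finally show ?thesis
    unfolding P(2) by (simp add: inner_matrix_trace matrix_mul_assoc)
qed

lemma norm_compression_le:
  fixes A P :: "real ^ 'n ^ 'n"
  assumes P: "transpose P = P" "P ** P = P"
  shows "norm (P ** A ** P) \<le> norm A"
proof (cases "P ** A ** P = 0")
  case False
  have "norm (P ** A ** P) * norm (P ** A ** P) \<le> norm A * norm (P ** A ** P)"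
    using norm_cauchy_schwarz[of A "P ** A ** P"] inner_compression[OF P, of A A]
    by (simp add: dot_square_norm power2_eq_square)
  with False show ?thesis by simp
qed simp

lemma norm_compression_gram:
  fixes P :: "real ^ 'n ^ 'n" and U :: "real ^ 'm ^ 'n"
  assumes P: "transpose P = P" "P ** P = P"
  shows "norm (P ** (U ** transpose U) ** P) = norm (transpose U ** P ** U)"
proof -
  \<comment> \<open>Dropping the compression on one side leaves two factors P under the trace, as
    many as occur in |U^T P U|^2.\<close>
  have "(P ** (U ** transpose U) ** P) \<bullet> (P ** (U ** transpose U) ** P)
      = (U ** transpose U) \<bullet> (P ** (U ** transpose U) ** P)"
    by (rule inner_compression[OF P, symmetric])
  also have "\<dots> = trace (U ** (transpose U ** P ** U ** transpose U ** P))"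
    by (simp add: inner_matrix_trace matrix_transpose_mul matrix_mul_assoc)
  also have "\<dots> = trace (transpose U ** P ** U ** transpose U ** P ** U)"
    by (rule trace_mul_sym)
  also have "\<dots> = (transpose U ** P ** U) \<bullet> (transpose U ** P ** U)"
    by (simp add: inner_matrix_trace matrix_transpose_mul P matrix_mul_assoc)
  finally show ?thesis by (simp add: norm_eq_sqrt_inner)
qed

text \<open>A is the sum of l b times the rank-one matrices b b^T, and these are orthonormal for the
  Frobenius inner product, since the inner product of b b^T and c c^T is (b . c)^2. The condition on
  the complement of \<open>span B\<close> allows B to be a basis of a subspace only.\<close>

lemma norm_matrix_eigenbasis:
  fixes A :: "real ^ 'n ^ 'n"
  assumes B: "finite B" "pairwise orthogonal B" "\<forall>b\<in>B. norm b = 1"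
    and eig: "\<And>b. b \<in> B \<Longrightarrow> A *v b = l b *\<^sub>R b"
    and zero: "\<And>x. x \<in> (span B)\<^sup>\<bottom> \<Longrightarrow> A *v x = 0"
  shows "(norm A)\<^sup>2 = (\<Sum>b\<in>B. (l b)\<^sup>2)"
proof -
  define R where "R b = (\<chi> i j. b $ i * b $ j)" for b :: "real ^ 'n"
  have R_mult: "R b *v x = (b \<bullet> x) *\<^sub>R b" for b x
    by (simp add: R_def vec_eq_iff matrix_vector_mult_def inner_vec_def sum_distrib_left mult_ac)
  have R_inner: "R b \<bullet> R c = (b \<bullet> c)\<^sup>2" for b c
  proof -
    have "R b \<bullet> R c = (\<Sum>i\<in>UNIV. \<Sum>j\<in>UNIV. (b $ i * c $ i) * (b $ j * c $ j))"
      by (simp add: R_def inner_vec_def mult_ac)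
    also have "\<dots> = (b \<bullet> c)\<^sup>2"
      by (simp add: inner_vec_def power2_eq_square sum_product)
    finally show ?thesis .
  qed
  have "A = (\<Sum>b\<in>B. l b *\<^sub>R R b)"
    unfolding matrix_eq
  proof
    fix x
    define y z where "y = orth_proj (span B) x" and "z = x - orth_proj (span B) x"
    have yz: "x = y + z" "y \<in> span B" "z \<in> (span B)\<^sup>\<bottom>"
      by (auto simp: y_def z_def orth_proj_in orth_proj_diff_in)
    have yex: "(\<Sum>b\<in>B. (y \<bullet> b) *\<^sub>R b) = y"
      using B yz(2) by (intro orthonormal_basis_expand) auto
    have inner: "x \<bullet> b = y \<bullet> b" if "b \<in> B" for b
      using yz span_base[OF that] by (auto simp: orthogonal_comp_def orthogonal_def inner_add_left inner_add_right inner_commute)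
    have "A *v x = A *v y"
      using yz zero by (simp add: matrix_vector_right_distrib)
    also have "\<dots> = (\<Sum>b\<in>B. (y \<bullet> b) *\<^sub>R (A *v b))"
      by (subst yex[symmetric]) (simp add: linear_sum[OF matrix_vector_mul_linear] linear_scale[OF matrix_vector_mul_linear])
    also have "\<dots> = (\<Sum>b\<in>B. (l b *\<^sub>R R b) *v x)"
      using eig inner by (intro sum.cong refl)
        (simp add: scaleR_matrix_vector_assoc[symmetric] R_mult inner_commute)
    also have "\<dots> = (\<Sum>b\<in>B. l b *\<^sub>R R b) *v x"
      by (induction B rule: infinite_finite_induct) (simp_all add: matrix_vector_mult_add_rdistrib)
    finally show "A *v x = (\<Sum>b\<in>B. l b *\<^sub>R R b) *v x" .
  qed
  then have "A \<bullet> A = (\<Sum>b\<in>B. \<Sum>c\<in>B. l b * l c * (b \<bullet> c)\<^sup>2)"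
    by (simp add: inner_sum_left inner_sum_right R_inner sum_distrib_left mult_ac inner_commute)
  also have "\<dots> = (\<Sum>b\<in>B. \<Sum>c\<in>B. if b = c then (l b)\<^sup>2 else 0)"
    using B by (intro sum.cong refl)
      (auto simp: pairwise_def orthogonal_def dot_square_norm power2_eq_square)
  also have "\<dots> = (\<Sum>b\<in>B. (l b)\<^sup>2)"
    using B by simp
  finally show ?thesis by (simp add: dot_square_norm)
qed

text \<open>The eigenvalue is 1 on an orthonormal basis of E and 0 on its complement; this is the
  source of the factor 1/m.\<close>

lemma norm_orth_proj_mat:
  fixes E :: "(real ^ 'n) set"
  assumes E: "subspace E"
  shows "(norm (orth_proj_mat E))\<^sup>2 = real (dim E)"
proof -
  obtain B where B: "B \<subseteq> E" "pairwise orthogonal B" "\<And>b. b \<in> B \<Longrightarrow> norm b = 1" "independent B"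
    "card B = dim E" "span B = E"
    using orthonormal_basis_subspace[OF E] by metis
  have "(norm (orth_proj_mat E))\<^sup>2 = (\<Sum>b\<in>B. 1\<^sup>2)"
  proof (rule norm_matrix_eigenbasis)
    show "finite B" using B(4) by (rule independent_imp_finite)
  qed (use B E in \<open>auto simp: orth_proj_mat_mult orth_proj_zero orth_proj_id\<close>)
  then show ?thesis using B by simp
qed


section \<open>Principal angles\<close>

text \<open>On E the composite of the two projections is self-adjoint, so it has an orthonormal
  eigenbasis. Its eigenvalues are l b = |Pi_N b|^2, which places them in [0,1] and makes their
  square roots admissible cosines.\<close>

lemma principal_eigenbasis:
  fixes E N :: "'a::euclidean_space set"
  assumes E: "subspace E" and N: "subspace N"
  obtains B l where "finite B" "pairwise orthogonal B" "\<forall>b\<in>B. norm b = 1" "span B = E" "card B = dim E"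
    "\<And>b. b \<in> B \<Longrightarrow> orth_proj E (orth_proj N b) = l b *\<^sub>R b"
    "\<And>b. b \<in> B \<Longrightarrow> 0 \<le> l b" "\<And>b. b \<in> B \<Longrightarrow> l b \<le> 1"
proof -
  let ?f = "\<lambda>x. orth_proj E (orth_proj N x)"
  define l where "l b = b \<bullet> ?f b" for b
  have f: "linear ?f"
    using linear_compose[OF linear_orth_proj[OF N] linear_orth_proj[OF E]] by (simp add: o_def)
  have sa: "?f x \<bullet> y = x \<bullet> ?f y" if "x \<in> E" "y \<in> E" for x y
    using that orth_proj_selfadjoint[OF E, of "orth_proj N x" y] orth_proj_selfadjoint[OF N, of x y]
      orth_proj_selfadjoint[OF E, of x "orth_proj N y"] by (simp add: orth_proj_id[OF E])
  have "?f ` E \<subseteq> E" using orth_proj_in[OF E] by auto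
  then obtain B where B: "B \<subseteq> E" "finite B" "pairwise orthogonal B" "\<forall>b\<in>B. norm b = 1" "span B = E"
    "\<forall>b\<in>B. ?f b = l b *\<^sub>R b"
    using selfadjoint_eigenbasis[OF f E _ sa] unfolding l_def by blast
  have "l b = orth_proj N b \<bullet> orth_proj N b" if "b \<in> B" for b
  proof -
    have "l b = b \<bullet> orth_proj N b"
      using orth_proj_selfadjoint[OF E, of b "orth_proj N b"] that B(1)
      by (simp add: l_def orth_proj_id[OF E] subset_iff)
    then show ?thesis by (simp only: orth_proj_inner[OF N, of b b])
  qed
  then have l: "l b = (norm (orth_proj N b))\<^sup>2" if "b \<in> B" for b
    using that by (simp add: dot_square_norm)
  have "l b \<le> 1" if "b \<in> B" for b
    using l[OF that] norm_orth_proj_le[OF N, of b] B(4) that by (simp add: power_le_one)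
  moreover have "card B = dim E"
    using orthonormal_independent[OF B(3,4)] B(5) dim_span_eq_card_independent by metis
  ultimately show ?thesis
    using B l by (intro that[of B l]) auto
qed

text \<open>The defining condition prescribes the multiplicity of every real number, hence the
  multiset of the list, and decreasing order then leaves a single list. Equality of multisets is
  enough for a sum over all angles.\<close>

lemma singular_values_on_orth_proj:
  fixes E N :: "'a::euclidean_space set"
  assumes E: "subspace E" and N: "subspace N"
    and B: "finite B" "pairwise orthogonal B" "\<forall>b\<in>B. norm b = 1" "span B = E"
    and eig: "\<And>b. b \<in> B \<Longrightarrow> orth_proj E (orth_proj N b) = l b *\<^sub>R b"
    and l0: "\<And>b. b \<in> B \<Longrightarrow> 0 \<le> l b"
  shows "mset (singular_values_on E (orth_proj N)) = image_mset (\<lambda>b. sqrt (l b)) (mset_set B)"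
proof -
  let ?f = "\<lambda>x. orth_proj E (orth_proj N x)"
  let ?M = "image_mset (\<lambda>b. sqrt (l b)) (mset_set B)"
  define s0 where "s0 = rev (sorted_list_of_multiset ?M)"
  have f: "linear ?f"
    using linear_compose[OF linear_orth_proj[OF N] linear_orth_proj[OF E]] by (simp add: o_def)
  \<comment> \<open>The projection onto N is self-adjoint and idempotent, so g* g for its
    restriction g to E is the projection onto N followed by the one onto E.\<close>
  have adj: "orth_proj E (adjoint (orth_proj N) (orth_proj N x)) = ?f x" for x
    by (simp add: adjoint_orth_proj[OF N] orth_proj_id[OF N orth_proj_in[OF N]])
  have count: "(if s \<ge> 0 then dim {x\<in>E. ?f x = s\<^sup>2 *\<^sub>R x} else 0) = count ?M s" for s
  proof -
    have "count ?M s = card {b \<in> B. s = sqrt (l b)}"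
      using B(1) by (simp add: count_image_mset')
    \<comment> \<open>Squaring identifies s with -s; the restriction to s \<ge> 0 counts each
      eigenvalue once.\<close>
    also have "{b \<in> B. s = sqrt (l b)} = (if s \<ge> 0 then {b \<in> B. l b = s\<^sup>2} else {})"
      using l0 by auto
    finally have "count ?M s = (if s \<ge> 0 then card {b \<in> B. l b = s\<^sup>2} else 0)"
      by (simp split: if_split)
    moreover have "dim {x\<in>E. ?f x = s\<^sup>2 *\<^sub>R x} = card {b \<in> B. l b = s\<^sup>2}"
      using dim_eigenspace[OF f B(1-3) eig, of "s\<^sup>2"] unfolding B(4) .
    ultimately show ?thesis by presburger
  qed
  have cl: "count_list xs s = count (mset xs) s" for xs :: "real list" and s
    by (induction xs) auto
  let ?P = "\<lambda>\<sigma>. sorted_wrt (\<ge>) \<sigma> \<and> (\<forall>s. count_list \<sigma> s =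
        (if s \<ge> 0 then dim {x\<in>E. orth_proj E (adjoint (orth_proj N) (orth_proj N x)) = s\<^sup>2 *\<^sub>R x} else 0))"
  have P: "?P \<sigma> \<longleftrightarrow> sorted_wrt (\<ge>) \<sigma> \<and> mset \<sigma> = ?M" for \<sigma>
    unfolding adj count cl multiset_eq_iff ..
  have "\<sigma> = s0" if "sorted_wrt (\<ge>) \<sigma>" "mset \<sigma> = ?M" for \<sigma>
  proof -
    have "sort (rev \<sigma>) = rev \<sigma>"
      using that(1) by (simp add: sorted_wrt_rev sort_key_id_if_sorted)
    then have "rev \<sigma> = sorted_list_of_multiset ?M"
      using that(2) by (metis mset_rev sorted_list_of_multiset_mset)
    then show ?thesis by (metis s0_def rev_rev_ident)
  qed
  moreover have "sorted_wrt (\<ge>) s0" "mset s0 = ?M"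
    by (auto simp: s0_def sorted_wrt_rev)
  ultimately have "singular_values_on E (orth_proj N) = s0"
    unfolding singular_values_on_def P by (intro the_equality) blast+
  then show ?thesis using \<open>mset s0 = ?M\<close> by simp
qed

lemma norm_compression_principal_angles:
  fixes E N :: "(real ^ 'n) set"
  assumes E: "subspace E" and N: "subspace N"
  shows "(norm (orth_proj_mat E ** orth_proj_mat N ** orth_proj_mat E))\<^sup>2
    = (\<Sum>j=1..dim E. cos (principal_angle E N j) ^ 4)"
proof -
  obtain B l where B: "finite B" "pairwise orthogonal B" "\<forall>b\<in>B. norm b = 1" "span B = E" "card B = dim E"
    and eig: "\<And>b. b \<in> B \<Longrightarrow> orth_proj E (orth_proj N b) = l b *\<^sub>R b"
    and l: "\<And>b. b \<in> B \<Longrightarrow> 0 \<le> l b" "\<And>b. b \<in> B \<Longrightarrow> l b \<le> 1"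
    using principal_eigenbasis[OF E N] by blast
  define \<sigma> where "\<sigma> = singular_values_on E (orth_proj N)"
  have \<sigma>: "mset \<sigma> = image_mset (\<lambda>b. sqrt (l b)) (mset_set B)"
    unfolding \<sigma>_def by (rule singular_values_on_orth_proj[OF E N B(1-4) eig l(1)])
  have "set \<sigma> = (\<lambda>b. sqrt (l b)) ` B"
    using arg_cong[OF \<sigma>, of set_mset] B(1) by simp
  then have range: "0 \<le> s \<and> s \<le> 1" if "s \<in> set \<sigma>" for s
    using that l by auto
  have len: "length \<sigma> = dim E"
    using arg_cong[OF \<sigma>, of size] B by simp
  have "(\<Sum>j=1..dim E. cos (principal_angle E N j) ^ 4) = (\<Sum>j<length \<sigma>. cos (arccos (\<sigma> ! j)) ^ 4)"
    unfolding principal_angle_def \<sigma>_def[symmetric] len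
    by (rule sum.reindex_bij_witness[of _ Suc "\<lambda>j. j - 1"]) auto
  \<comment> \<open>\<open>cos\<close> undoes \<open>arccos\<close> only on [-1,1], hence the need
    for \<open>range\<close>.\<close>
  also have "\<dots> = (\<Sum>j<length \<sigma>. (\<sigma> ! j) ^ 4)"
    using range by (intro sum.cong refl arg_cong[of _ _ "\<lambda>x. x ^ 4"] cos_arccos)
      (force dest: nth_mem)+
  also have "\<dots> = sum_list (map (\<lambda>s. s ^ 4) \<sigma>)"
    by (simp add: sum_list_sum_nth atLeast0LessThan)
  also have "\<dots> = sum_mset (image_mset (\<lambda>s. s ^ 4) (mset \<sigma>))"
    by (simp flip: sum_mset_sum_list)
  also have "\<dots> = (\<Sum>b\<in>B. sqrt (l b) ^ 4)"
    by (simp add: \<sigma> sum_unfold_sum_mset multiset.map_comp o_def)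
  also have "\<dots> = (\<Sum>b\<in>B. (l b)\<^sup>2)"
  proof (rule sum.cong[OF refl])
    fix b assume "b \<in> B"
    then have "(sqrt (l b))\<^sup>2 = l b" using l by simp
    then show "sqrt (l b) ^ 4 = (l b)\<^sup>2" by (metis power_mult numeral_times_numeral semiring_norm(12,13))
  qed
  also have "\<dots> = (norm (orth_proj_mat E ** orth_proj_mat N ** orth_proj_mat E))\<^sup>2"
  proof (rule norm_matrix_eigenbasis[symmetric, OF B(1-3)])
    fix b assume b: "b \<in> B"
    then have "b \<in> E" using B(4) span_base by blast
    then show "(orth_proj_mat E ** orth_proj_mat N ** orth_proj_mat E) *v b = l b *\<^sub>R b"
      using eig[OF b] E N
      by (simp add: matrix_vector_mul_assoc[symmetric] orth_proj_mat_mult orth_proj_id)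
  next
    fix x assume "x \<in> (span B)\<^sup>\<bottom>"
    then show "(orth_proj_mat E ** orth_proj_mat N ** orth_proj_mat E) *v x = 0"
      using E N B(4)
      by (simp add: matrix_vector_mul_assoc[symmetric] orth_proj_mat_mult orth_proj_zero
          linear_0[OF linear_orth_proj])
  qed
  finally show ?thesis by simp
qed


section \<open>The pseudoinverse and the null-space projector\<close>

lemma mat_mult_on_assoc:
  "mat_mult_on L (mat_mult_on K A B) C i j = mat_mult_on K A (mat_mult_on L B C) i j"
  unfolding mat_mult_on_def sum_distrib_left sum_distrib_right
  by (subst sum.swap) (simp add: mult.assoc)

lemma mat_mult_on_cong:
  assumes "\<And>k. k \<in> K \<Longrightarrow> A i k = A' i k" "\<And>k. k \<in> K \<Longrightarrow> B k j = B' k j"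
  shows "mat_mult_on K A B i j = mat_mult_on K A' B' i j"
  unfolding mat_mult_on_def using assms by (intro sum.cong) auto

lemma mat_mult_on_swap:
  assumes "\<And>i j. i \<in> K \<Longrightarrow> j \<in> K \<Longrightarrow> A i j = A j i"
    and "\<And>i j. i \<in> K \<Longrightarrow> j \<in> K \<Longrightarrow> B i j = B j i"
    and "i \<in> K" "j \<in> K"
  shows "mat_mult_on K A B i j = mat_mult_on K B A j i"
  unfolding mat_mult_on_def
proof (rule sum.cong[OF refl])
  fix k assume "k \<in> K"
  then show "A i k * B k j = B j k * A k i"
    using assms(1)[of i k] assms(2)[of k j] assms(3,4) by simp
qed

lemma is_pseudoinverse_onD:
  assumes "is_pseudoinverse_on I J X Y"
  shows "i \<in> I \<Longrightarrow> j \<in> J \<Longrightarrow> mat_mult_on I (mat_mult_on J X Y) X i j = X i j"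
    and "j \<in> J \<Longrightarrow> i \<in> I \<Longrightarrow> mat_mult_on J (mat_mult_on I Y X) Y j i = Y j i"
    and "i \<in> I \<Longrightarrow> i' \<in> I \<Longrightarrow> mat_mult_on J X Y i i' = mat_mult_on J X Y i' i"
    and "j \<in> J \<Longrightarrow> j' \<in> J \<Longrightarrow> mat_mult_on I Y X j j' = mat_mult_on I Y X j' j"
  using assms unfolding is_pseudoinverse_on_def by blast+

text \<open>Penrose's argument: X Y = (X Z)(X Y) = ((X Y)(X Z))^T = (X Z)^T = X Z, as both products
  are symmetric, and likewise Y X = Z X. Therefore Y = Y X Y = Z X Y = Z X Z = Z.\<close>

lemma is_pseudoinverse_on_unique:
  assumes Y: "is_pseudoinverse_on I J X Y" and Z: "is_pseudoinverse_on I J X Z"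
    and ij: "i \<in> I" "j \<in> J"
  shows "Y j i = Z j i"
proof -
  have absorb_left: "mat_mult_on I (mat_mult_on J X W) (mat_mult_on J X V) i i' = mat_mult_on J X V i i'"
    if "is_pseudoinverse_on I J X W" "i \<in> I" for V W i i'
    unfolding mat_mult_on_assoc[symmetric]
    by (rule mat_mult_on_cong) (simp_all add: is_pseudoinverse_onD(1)[OF that(1)] that(2))
  have absorb_right: "mat_mult_on J (mat_mult_on I V X) (mat_mult_on I W X) j j' = mat_mult_on I V X j j'"
    if "is_pseudoinverse_on I J X W" "j' \<in> J" for V W j j'
  proof -
    have "mat_mult_on J (mat_mult_on I V X) (mat_mult_on I W X) j j'
        = mat_mult_on I V (mat_mult_on I (mat_mult_on J X W) X) j j'"
      by (simp only: mat_mult_on_assoc[of J I V X] mat_mult_on_assoc[of I J X W, symmetric, abs_def])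
    also have "\<dots> = mat_mult_on I V X j j'"
      by (rule mat_mult_on_cong) (simp_all add: is_pseudoinverse_onD(1)[OF that(1)] that(2))
    finally show ?thesis .
  qed
  have left: "mat_mult_on J X Y i i' = mat_mult_on J X Z i i'" if ii: "i \<in> I" "i' \<in> I" for i i'
  proof -
    have "mat_mult_on J X Y i i' = mat_mult_on I (mat_mult_on J X Z) (mat_mult_on J X Y) i i'"
      by (rule absorb_left[OF Z ii(1), symmetric])
    also have "\<dots> = mat_mult_on I (mat_mult_on J X Y) (mat_mult_on J X Z) i' i"
      by (rule mat_mult_on_swap[OF is_pseudoinverse_onD(3)[OF Z] is_pseudoinverse_onD(3)[OF Y] ii])
    also have "\<dots> = mat_mult_on J X Z i' i"
      by (rule absorb_left[OF Y ii(2)])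
    also have "\<dots> = mat_mult_on J X Z i i'"
      by (rule is_pseudoinverse_onD(3)[OF Z ii(2,1)])
    finally show ?thesis .
  qed
  have right: "mat_mult_on I Y X j j' = mat_mult_on I Z X j j'" if jj: "j \<in> J" "j' \<in> J" for j j'
  proof -
    have "mat_mult_on I Y X j j' = mat_mult_on J (mat_mult_on I Y X) (mat_mult_on I Z X) j j'"
      by (rule absorb_right[OF Z jj(2), symmetric])
    also have "\<dots> = mat_mult_on J (mat_mult_on I Z X) (mat_mult_on I Y X) j' j"
      by (rule mat_mult_on_swap[OF is_pseudoinverse_onD(4)[OF Y] is_pseudoinverse_onD(4)[OF Z] jj])
    also have "\<dots> = mat_mult_on I Z X j' j"
      by (rule absorb_right[OF Y jj(1)])
    also have "\<dots> = mat_mult_on I Z X j j'"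
      by (rule is_pseudoinverse_onD(4)[OF Z jj(2,1)])
    finally show ?thesis .
  qed
  have "Y j i = mat_mult_on J (mat_mult_on I Y X) Y j i"
    by (rule is_pseudoinverse_onD(2)[OF Y ij(2,1), symmetric])
  also have "\<dots> = mat_mult_on J (mat_mult_on I Z X) Y j i"
    by (rule mat_mult_on_cong) (simp_all add: right ij)
  also have "\<dots> = mat_mult_on I Z (mat_mult_on J X Y) j i"
    by (rule mat_mult_on_assoc)
  also have "\<dots> = mat_mult_on I Z (mat_mult_on J X Z) j i"
    by (rule mat_mult_on_cong) (simp_all add: left ij)
  also have "\<dots> = mat_mult_on J (mat_mult_on I Z X) Z j i"
    by (rule mat_mult_on_assoc[symmetric])
  also have "\<dots> = Z j i"
    by (rule is_pseudoinverse_onD(2)[OF Z ij(2,1)])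
  finally show ?thesis .
qed

lemma pseudoinverse_on_eqI:
  assumes "is_pseudoinverse_on I J X Y" "\<And>j i. j \<notin> J \<or> i \<notin> I \<Longrightarrow> Y j i = 0"
  shows "pseudoinverse_on I J X = Y"
  unfolding pseudoinverse_on_def
proof (rule the_equality)
  fix Z assume Z: "is_pseudoinverse_on I J X Z \<and> (\<forall>j i. j \<notin> J \<or> i \<notin> I \<longrightarrow> Z j i = 0)"
  show "Z = Y"
  proof (intro ext)
    fix j i
    show "Z j i = Y j i"
      using is_pseudoinverse_on_unique[of I J X Z Y i j] Z assms by (cases "j \<in> J \<and> i \<in> I") auto
  qed
qed (use assms in blast)

section \<open>The null-space projector of a task\<close>

lemma subspace_task_null: "subspace (task_null \<tau>)"
  by (cases \<tau>) (auto simp: subspace_def inner_add_right)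

(* With p the projector onto the null space of X and g = X^T X, the operator g + p is invertible,
   and X^+ = (g + p)^-1 X^T. *)
lemma task_proj_eq_orth_proj_mat:
  fixes \<tau> :: "'d::finite task"
  shows "task_proj \<tau> = orth_proj_mat (task_null \<tau>)"
proof -
  obtain n X y where \<tau>: "\<tau> = (n, X, y)" by (cases \<tau>)
  define N where "N = task_null \<tau>"
  have N: "subspace N" unfolding N_def by (rule subspace_task_null)
  have N_iff: "v \<in> N \<longleftrightarrow> (\<forall>i<n. X i \<bullet> v = 0)" for v by (simp add: N_def \<tau>)
  define p where "p = orth_proj N"
  define g where "g v = (\<Sum>i<n. (X i \<bullet> v) *\<^sub>R X i)" for v
  have p: "linear p" unfolding p_def by (rule linear_orth_proj[OF N])
  have g: "linear g"
    unfolding g_def by (rule linearI)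
      (simp_all add: inner_add_right scaleR_add_left sum.distrib scaleR_sum_right)
  have pX: "p (X i) = 0" if "i < n" for i
    unfolding p_def using that
    by (intro orth_proj_zero[OF N]) (simp add: orthogonal_comp_def orthogonal_def N_iff inner_commute)
  have pg: "p (g v) = 0" for v
    by (simp add: g_def linear_sum[OF p] linear_scale[OF p] pX)
  have gp: "g (p v) = 0" for v
    using orth_proj_in[OF N, of v] by (simp add: g_def p_def[symmetric] N_iff)
  have pp: "p (p v) = p v" for v
    by (simp add: p_def orth_proj_id[OF N] orth_proj_in[OF N])
  have psa: "p u \<bullet> v = u \<bullet> p v" for u v
    unfolding p_def by (rule orth_proj_selfadjoint[OF N])
  have gsa: "g u \<bullet> v = u \<bullet> g v" for u v
    by (simp add: g_def inner_sum_left inner_sum_right inner_commute mult.commute)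
  define k where "k v = g v + p v" for v
  have k: "linear k" unfolding k_def by (rule linear_compose_add[OF g p])
  \<comment> \<open>Applying p to g v + p v = 0 leaves p v = 0, because p g = 0. Then g v = 0, and g
    v . v is the sum of the squares (X_i . v)^2, so v lies in N and v = p v = 0.\<close>
  have "v = 0" if "k v = 0" for v
  proof -
    have pv: "p v = 0"
      using arg_cong[OF that, of p] by (simp add: k_def linear_add[OF p] pg pp linear_0[OF p])
    then have gv: "g v = 0" using that by (simp add: k_def)
    have "(\<Sum>i<n. (X i \<bullet> v)\<^sup>2) = g v \<bullet> v"
      by (simp add: g_def inner_sum_left power2_eq_square)
    also have "\<dots> = 0" by (simp add: gv)
    finally have "\<forall>i<n. X i \<bullet> v = 0"
      by (simp add: sum_nonneg_eq_0_iff)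
    then have "v \<in> N" by (simp add: N_iff)
    then show "v = 0" using pv by (simp add: p_def orth_proj_id[OF N])
  qed
  then have "inj k" using linear_injective_0[OF k] by blast
  then obtain h where h: "linear h" "\<And>v. h (k v) = v" "\<And>v. k (h v) = v"
    using linear_injective_isomorphism[OF k] by metis
  have hsa: "h u \<bullet> v = u \<bullet> h v" for u v
  proof -
    have "h u \<bullet> k (h v) = k (h u) \<bullet> h v"
      by (simp add: k_def inner_add_left inner_add_right gsa psa)
    then show ?thesis by (simp add: h)
  qed
  \<comment> \<open>Since Y X acts as h g for the matrix Y defined below, this is the identity X^+ X
    = I - p.\<close>
  have hg: "h (g v) = v - p v" for v
  proof -
    have "k (v - p v) = g v"
      by (simp add: k_def linear_diff[OF g] linear_diff[OF p] gp pp)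
    then show ?thesis by (metis h(2))
  qed
  have ph: "p (h (X i)) = 0" if "i < n" for i
    using arg_cong[OF h(3)[of "X i"], of p] pX[OF that]
    by (simp add: k_def linear_add[OF p] pg pp)
  define A where "A = (\<lambda>i j. X i $ j)"
  define Y where "Y j i = (if i < n then h (X i) $ j else 0)" for j i
  have YX: "mat_mult_on {..<n} Y A j j' = axis j 1 \<bullet> (axis j' 1 - p (axis j' 1))" for j j'
  proof -
    have "mat_mult_on {..<n} Y A j j' = axis j 1 \<bullet> h (g (axis j' 1))"
      by (simp add: mat_mult_on_def Y_def A_def g_def linear_sum[OF h(1)] linear_scale[OF h(1)]
          inner_axis inner_axis' inner_sum_right mult.commute)
    then show ?thesis by (simp add: hg)
  qed
  have XY: "mat_mult_on UNIV A Y i i' = X i \<bullet> h (X i')" if "i' < n" for i i'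
    using that by (simp add: mat_mult_on_def A_def Y_def inner_vec_def)
  have sym: "mat_mult_on {..<n} Y A j j' = mat_mult_on {..<n} Y A j' j" for j j'
    using psa[of "axis j 1" "axis j' 1"] unfolding YX inner_diff_right by (simp add: inner_commute)
  \<comment> \<open>Multiplication by Y X = I - p fixes every u with p u = 0. The first two Penrose
    conditions are the instances u = X i and u = h (X i), both annihilated by p.\<close>
  have row: "(\<Sum>j\<in>UNIV. u $ j * mat_mult_on {..<n} Y A j j') = u \<bullet> (axis j' 1 - p (axis j' 1))" for u j'
    unfolding YX by (simp add: inner_axis' inner_vec_def[of u])
  have "is_pseudoinverse_on {..<n} UNIV A Y"
    unfolding is_pseudoinverse_on_def
  proof (intro conjI ballI)
    fix i j assume i: "i \<in> {..<n}"
    have "mat_mult_on {..<n} (mat_mult_on UNIV A Y) A i j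
        = (\<Sum>k\<in>UNIV. X i $ k * mat_mult_on {..<n} Y A k j)"
      unfolding mat_mult_on_assoc by (simp add: mat_mult_on_def[of UNIV] A_def)
    also have "\<dots> = A i j"
      using pX i unfolding row by (simp add: inner_diff_right psa[symmetric] inner_axis A_def)
    finally show "mat_mult_on {..<n} (mat_mult_on UNIV A Y) A i j = A i j" .
  next
    fix j i assume i: "i \<in> {..<n}"
    have "mat_mult_on UNIV (mat_mult_on {..<n} Y A) Y j i
        = (\<Sum>k\<in>UNIV. h (X i) $ k * mat_mult_on {..<n} Y A k j)"
      using i by (simp add: mat_mult_on_def[of UNIV] Y_def[of _ i] sym[of j] mult.commute)
    also have "\<dots> = Y j i"
      using ph i unfolding row by (simp add: inner_diff_right psa[symmetric] inner_axis Y_def)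
    finally show "mat_mult_on UNIV (mat_mult_on {..<n} Y A) Y j i = Y j i" .
  next
    fix i i' assume "i \<in> {..<n}" "i' \<in> {..<n}"
    then show "mat_mult_on UNIV A Y i i' = mat_mult_on UNIV A Y i' i"
      using hsa[of "X i" "X i'"] by (simp add: XY inner_commute)
  next
    fix j j' show "mat_mult_on {..<n} Y A j j' = mat_mult_on {..<n} Y A j' j"
      by (rule sym)
  qed
  then have "pseudoinverse_on {..<n} UNIV A = Y"
    by (rule pseudoinverse_on_eqI) (auto simp: Y_def)
  then have tp: "task_proj \<tau> $ i $ j = (if i = j then 1 else 0) - mat_mult_on {..<n} Y A i j" for i j
    by (simp add: \<tau> A_def mat_def)
  have ax: "(axis j 1 :: real ^ 'd) $ i = (if i = j then 1 else 0)" for i j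
    by (simp add: axis_def)
  have "task_proj \<tau> $ i $ j = orth_proj_mat N $ i $ j" for i j
    by (simp add: tp YX inner_diff_right inner_axis' ax orth_proj_mat_def matrix_def p_def)
  then show ?thesis by (simp add: vec_eq_iff N_def)
qed

lemma transpose_task_proj: "transpose (task_proj \<tau>) = task_proj \<tau>"
  unfolding task_proj_eq_orth_proj_mat by (rule transpose_orth_proj_mat[OF subspace_task_null])

lemma task_proj_idem: "task_proj \<tau> ** task_proj \<tau> = task_proj \<tau>"
  unfolding task_proj_eq_orth_proj_mat by (rule orth_proj_mat_idem[OF subspace_task_null])


section \<open>Measurability of the null-space projector\<close>

(* One Gram-Schmidt step per row, so that measurability is visible.  If row k depends on the
   previous ones, then r = 0 and the correction vanishes because inverse 0 = 0. *)
primrec null_proj :: "(nat \<Rightarrow> real ^ 'd::finite) \<Rightarrow> nat \<Rightarrow> real ^ 'd ^ 'd" where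
  "null_proj X 0 = mat 1"
| "null_proj X (Suc k) = null_proj X k -
     (let r = null_proj X k *v X k in inverse ((norm r)\<^sup>2) *\<^sub>R (\<chi> i j. r $ i * r $ j))"

lemma outer_product_mult:
  fixes r x :: "real ^ 'd"
  shows "(\<chi> i j. r $ i * r $ j) *v x = (r \<bullet> x) *\<^sub>R r"
  by (simp add: vec_eq_iff matrix_vector_mult_def inner_vec_def sum_distrib_left mult_ac)

text \<open>On the old null space N, pairing with X n equals pairing with r = p (X n). The new null
  space is therefore the complement of r within N, and its projector is p minus the projector onto
  the span of r.\<close>

lemma null_proj_eq_orth_proj_mat: "null_proj X n = orth_proj_mat {v. \<forall>i<n. X i \<bullet> v = 0}"
proof (induction n)
  case 0
  show ?case
    by (rule orth_proj_mat_eqI[symmetric]) (auto simp: orthogonal_comp_def orthogonal_def subspace_UNIV)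
next
  case (Suc n)
  define N where "N = {v. \<forall>i<n. X i \<bullet> v = 0}"
  define N' where "N' = {v. \<forall>i<Suc n. X i \<bullet> v = 0}"
  have N: "subspace N" "subspace N'"
    by (auto simp: N_def N'_def subspace_def inner_add_right)
  have N'_iff: "v \<in> N' \<longleftrightarrow> v \<in> N \<and> X n \<bullet> v = 0" for v
    by (auto simp: N_def N'_def less_Suc_eq)
  define p where "p = orth_proj N"
  define r where "r = p (X n)"
  define c where "c x = inverse ((norm r)\<^sup>2) * (r \<bullet> x)" for x
  have pN: "p x \<in> N" for x unfolding p_def by (rule orth_proj_in[OF N(1)])
  have step: "null_proj X (Suc n) *v x = p x - c x *\<^sub>R r" for x
    using N(1) by (simp add: Suc Let_def N_def[symmetric] orth_proj_mat_mult matrix_vector_mult_diff_rdistrib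
        scaleR_matrix_vector_assoc[symmetric] outer_product_mult p_def r_def c_def)
  show ?case unfolding N'_def[symmetric]
  proof (rule orth_proj_mat_eqI[OF N(2), symmetric])
    fix x
    have Xr: "X n \<bullet> p x = r \<bullet> x"
      unfolding r_def p_def by (rule orth_proj_selfadjoint[OF N(1), symmetric])
    have rr: "X n \<bullet> r = (norm r)\<^sup>2"
      unfolding r_def p_def by (subst orth_proj_inner[OF N(1)]) (simp add: dot_square_norm)
    \<comment> \<open>For r = 0 the identity X n . p x = r . x already gives 0; otherwise c x is the
      coefficient that cancels.\<close>
    have "X n \<bullet> (p x - c x *\<^sub>R r) = 0"
      by (cases "r = 0") (simp_all add: inner_diff_right Xr rr c_def)
    then show "null_proj X (Suc n) *v x \<in> N'"
      using pN N(1) unfolding step N'_iff by (auto simp: r_def subspace_diff subspace_scale)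
    have perp: "v \<bullet> (y - p y) = 0" if "v \<in> N" for v y
      using orth_proj_diff_in[OF N(1), of y] that by (auto simp: p_def orthogonal_comp_def orthogonal_def)
    have "v \<bullet> (x - (p x - c x *\<^sub>R r)) = 0" if "v \<in> N'" for v
    proof -
      have "v \<in> N" "X n \<bullet> v = 0" using that by (auto simp: N'_iff)
      then have "v \<bullet> r = 0"
        using perp[of v "X n"] by (simp add: r_def inner_diff_right inner_commute)
      then show ?thesis
        using perp[OF \<open>v \<in> N\<close>, of x] by (simp add: inner_diff_right)
    qed
    then show "x - null_proj X (Suc n) *v x \<in> N'\<^sup>\<bottom>"
      unfolding step by (simp add: orthogonal_comp_def orthogonal_def)
  qed
qed

text \<open>The only discontinuous ingredient of the recursion is the scalar \<open>inverse\<close>,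
  which is Borel; the others are polynomial in the entries.\<close>

lemma borel_measurable_null_proj:
  fixes X :: "'a \<Rightarrow> nat \<Rightarrow> real ^ 'd"
  assumes X: "\<And>i. (\<lambda>\<tau>. X \<tau> i) \<in> borel_measurable M"
  shows "(\<lambda>\<tau>. null_proj (X \<tau>) n) \<in> borel_measurable M"
proof (induction n)
  case (Suc n)
  have "continuous_on UNIV (\<lambda>x :: (real ^ 'd ^ 'd) \<times> (real ^ 'd). fst x *v snd x)"
    unfolding matrix_vector_mult_def by (intro continuous_intros)
  then have r: "(\<lambda>\<tau>. null_proj (X \<tau>) n *v X \<tau> n) \<in> borel_measurable M"
    by (rule borel_measurable_continuous_Pair[where H = "(*v)", OF Suc X])
  have "continuous_on UNIV (\<lambda>r :: real ^ 'd. \<chi> i j. r $ i * r $ j)"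
    by (intro continuous_intros)
  note outer = borel_measurable_continuous_on[OF this r]
  have "(\<lambda>\<tau>. inverse ((norm (null_proj (X \<tau>) n *v X \<tau> n))\<^sup>2)) \<in> borel_measurable M"
    using r by measurable
  from borel_measurable_diff[OF Suc borel_measurable_scaleR[OF this outer]] show ?case
    unfolding null_proj.simps Let_def .
qed simp

lemma task_proj_eq_null_proj: "task_proj \<tau> = null_proj (fst (snd \<tau>)) (fst \<tau>)"
  unfolding task_proj_eq_orth_proj_mat null_proj_eq_orth_proj_mat by (cases \<tau>) simp

text \<open>The number of rows is itself random, so the countably many maps for fixed n are glued
  along the first component, measurable into the discrete space of naturals.\<close>

lemma borel_measurable_task_proj: "task_proj \<in> borel_measurable task_space"
proof -
  have "continuous_on UNIV (\<lambda>\<tau> :: 'a task. fst (snd \<tau>))"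
    by (intro continuous_on_fst continuous_on_snd continuous_on_id)
  then have "(\<lambda>\<tau> :: 'a task. fst (snd \<tau>) i) \<in> borel_measurable borel" for i
    by (intro borel_measurable_continuous_onI) (rule continuous_on_product_then_coordinatewise)
  then have "(\<lambda>\<tau> :: 'a task. null_proj (fst (snd \<tau>)) n) \<in> borel_measurable borel" for n
    by (rule borel_measurable_null_proj)
  moreover have "(fst :: 'a task \<Rightarrow> nat) \<in> measurable borel (count_space UNIV)"
  proof -
    have "(fst :: 'a task \<Rightarrow> nat) \<in> borel_measurable borel"
      by (intro borel_measurable_continuous_onI continuous_on_fst continuous_on_id)
    then show ?thesis
      using measurable_cong_sets[of "borel :: 'a task measure" borel "borel :: nat measure" "count_space UNIV"]
      by (simp add: sets_borel_eq_count_space)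
  qed
  ultimately have "(\<lambda>\<tau> :: 'a task. null_proj (fst (snd \<tau>)) (fst \<tau>)) \<in> borel_measurable borel"
    by (rule measurable_compose_countable)
  then show ?thesis
    unfolding task_space_def task_proj_eq_null_proj[abs_def] by (rule measurable_restrict_space1)
qed


section \<open>The operator S\<close>

lemma linear_compression:
  fixes P :: "real ^ 'd ^ 'd"
  shows "linear (\<lambda>A. P ** A ** P)"
  by (rule linearI)
    (simp_all add: matrix_add_ldistrib matrix_scalar_ac scalar_matrix_assoc[symmetric],
     simp add: vec_eq_iff matrix_matrix_mult_def sum.distrib distrib_right)

lemma borel_measurable_compression:
  fixes A :: "real ^ 'd ^ 'd"
  shows "(\<lambda>\<tau>. task_proj \<tau> ** A ** task_proj \<tau>) \<in> borel_measurable task_space"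
proof -
  have "continuous_on UNIV (\<lambda>P :: real ^ 'd ^ 'd. P ** A ** P)"
    unfolding matrix_matrix_mult_def by (intro continuous_intros)
  from borel_measurable_continuous_on[OF this borel_measurable_task_proj] show ?thesis .
qed

context
  fixes \<mu> :: "'d::finite task measure"
  assumes \<mu>: "task_distribution \<mu>"
begin

lemma prob_space_task_distribution: "prob_space \<mu>"
  using \<mu> by (simp add: task_distribution_def)

text \<open>Compression never increases the norm, so the constant |A| dominates. Integrability must
  be established because the Bochner integral is 0 by convention on nonintegrable functions, which
  would spoil linearity of S.\<close>

lemma integrable_compression: "integrable \<mu> (\<lambda>\<tau>. task_proj \<tau> ** A ** task_proj \<tau>)"
proof -
  interpret prob_space \<mu> by (rule prob_space_task_distribution)
  have "sets \<mu> = sets task_space" using \<mu> by (simp add: task_distribution_def)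
  then have "(\<lambda>\<tau>. task_proj \<tau> ** A ** task_proj \<tau>) \<in> borel_measurable \<mu>"
    using borel_measurable_compression[of A] measurable_cong_sets by blast
  then show ?thesis
    by (rule integrable_const_bound[of _ "norm A", rotated])
      (simp add: norm_compression_le transpose_task_proj task_proj_idem)
qed

text \<open>Taking the inner product inside the integral and compressing A as well gives an
  expression symmetric in A and B and nonnegative for A = B; S inherits self-adjointness and
  positivity from it.\<close>

lemma inner_S_op:
  "A \<bullet> S_op \<mu> B = (\<integral>\<tau>. (task_proj \<tau> ** A ** task_proj \<tau>) \<bullet> (task_proj \<tau> ** B ** task_proj \<tau>) \<partial>\<mu>)"
  unfolding S_op_def integral_inner_right[OF integrable_compression, symmetric]
  by (intro Bochner_Integration.integral_cong refl inner_compression transpose_task_proj task_proj_idem)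

lemma I_ratio_eq: "I_ratio \<mu> A = (A \<bullet> S_op \<mu> A) / (norm A)\<^sup>2"
  unfolding I_ratio_def inner_S_op by (simp only: dot_square_norm)

lemma linear_S_op: "linear (S_op \<mu>)"
  unfolding S_op_def
  by (rule linearI)
    (simp_all add: linear_add[OF linear_compression] linear_scale[OF linear_compression]
      integrable_compression)

lemma S_op_sym_mats: "A \<in> sym_mats \<Longrightarrow> S_op \<mu> A \<in> sym_mats"
proof -
  assume A: "A \<in> sym_mats"
  have "linear (transpose :: real ^ 'd ^ 'd \<Rightarrow> real ^ 'd ^ 'd)"
    by (rule linearI) (simp_all add: transpose_def vec_eq_iff)
  then have "bounded_linear (transpose :: real ^ 'd ^ 'd \<Rightarrow> real ^ 'd ^ 'd)"
    by (simp add: linear_conv_bounded_linear)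
  from integral_bounded_linear[OF this integrable_compression[of A]] A
  show ?thesis
    by (simp add: S_op_def sym_mats_def matrix_transpose_mul transpose_task_proj matrix_mul_assoc)
qed

text \<open>Contraction passes to S under the integral, |S A| \<le> E |P A P| \<le> |A|, and
  Cauchy-Schwarz then bounds the Rayleigh quotient.\<close>

lemma I_ratio_le_1:
  assumes "A \<noteq> 0"
  shows "I_ratio \<mu> A \<le> 1"
proof -
  interpret prob_space \<mu> by (rule prob_space_task_distribution)
  have "norm (S_op \<mu> A) \<le> (\<integral>\<tau>. norm (task_proj \<tau> ** A ** task_proj \<tau>) \<partial>\<mu>)"
    unfolding S_op_def by (rule integral_norm_bound)
  also have "\<dots> \<le> norm A"
    by (intro integral_le_const integrable_norm integrable_compression)
      (simp add: norm_compression_le transpose_task_proj task_proj_idem)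
  finally have "norm A * norm (S_op \<mu> A) \<le> norm A * norm A"
    by (rule mult_left_mono) simp
  with norm_cauchy_schwarz[of A "S_op \<mu> A"] have "A \<bullet> S_op \<mu> A \<le> (norm A)\<^sup>2"
    unfolding power2_eq_square by linarith
  then show ?thesis using assms by (simp add: I_ratio_eq)
qed

lemma I_ratio_max:
  shows "\<exists>A\<in>sym_mats. A \<noteq> 0 \<and> I_ratio \<mu> A = rho \<mu>"
    and "\<And>A. A \<in> sym_mats \<Longrightarrow> A \<noteq> 0 \<Longrightarrow> I_ratio \<mu> A \<le> rho \<mu>"
proof -
  \<comment> \<open>The identity matrix is a witness; index types are nonempty, so
    \<open>undefined\<close> serves as an index.\<close>
  have "(sym_mats :: (real ^ 'd ^ 'd) set) \<noteq> {0}"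
  proof
    assume *: "(sym_mats :: (real ^ 'd ^ 'd) set) = {0}"
    have "mat 1 \<in> (sym_mats :: (real ^ 'd ^ 'd) set)" by (simp add: sym_mats_def)
    then have "(mat 1 :: real ^ 'd ^ 'd) $ undefined $ undefined = 0" unfolding * by simp
    then show False by (simp add: mat_def)
  qed
  moreover have "subspace (sym_mats :: (real ^ 'd ^ 'd) set)"
    by (auto simp: sym_mats_def subspace_def transpose_def vec_eq_iff)
  moreover have "S_op \<mu> A \<bullet> B = A \<bullet> S_op \<mu> B" for A B
    unfolding inner_commute[of "S_op \<mu> A"] inner_S_op by (simp only: inner_commute)
  moreover have "0 \<le> A \<bullet> S_op \<mu> A" for A
    unfolding inner_S_op by simp
  ultimately show "\<exists>A\<in>sym_mats. A \<noteq> 0 \<and> I_ratio \<mu> A = rho \<mu>"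
    and "\<And>A. A \<in> sym_mats \<Longrightarrow> A \<noteq> 0 \<Longrightarrow> I_ratio \<mu> A \<le> rho \<mu>"
    unfolding I_ratio_eq rho_def
    using rayleigh_max_eq_onorm_on[OF linear_S_op, of sym_mats] S_op_sym_mats by blast+
qed

text \<open>Change of variables along \<open>T t\<close>, whose law is \<mu>; this is where the
  integrand must be Borel on \<open>task_space\<close>.\<close>

lemma I_ratio_iid:
  assumes iid: "iid_tasks M T \<mu>" and t: "t \<ge> 1"
  shows "I_ratio \<mu> A
    = (\<integral>\<omega>. (norm (task_proj (T t \<omega>) ** A ** task_proj (T t \<omega>)))\<^sup>2 \<partial>M) / (norm A)\<^sup>2"
proof -
  interpret prob_space M using iid by (simp add: iid_tasks_def)
  have T: "T t \<in> measurable M task_space" and \<mu>_eq: "distr M task_space (T t) = \<mu>"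
    using iid t by (auto simp: iid_tasks_def indep_vars_def)
  have "(\<lambda>\<tau>. (norm (task_proj \<tau> ** A ** task_proj \<tau>))\<^sup>2) \<in> borel_measurable task_space"
    by (intro borel_measurable_power measurable_compose[OF borel_measurable_compression]
        borel_measurable_norm)
  from integral_distr[OF T this] show ?thesis
    unfolding I_ratio_def \<mu>_eq by simp
qed

end

theorem proposition4p3:
  fixes \<mu> :: "'d::finite task measure"
    and M :: "'w measure"
    and T :: "nat \<Rightarrow> 'w \<Rightarrow> 'd task"
    and t :: nat
  assumes "task_distribution \<mu>"
    and "iid_tasks M T \<mu>"
    and "t \<ge> 1"
  shows "(\<forall>A\<in>sym_mats. A \<noteq> 0 \<longrightarrow> 0 \<le> I_ratio \<mu> A \<and> I_ratio \<mu> A \<le> 1)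
    \<and> ((\<exists>A\<in>sym_mats. A \<noteq> 0 \<and> I_ratio \<mu> A = rho \<mu>)
        \<and> (\<forall>A\<in>sym_mats. A \<noteq> 0 \<longrightarrow> I_ratio \<mu> A \<le> rho \<mu>))
    \<and> (\<forall>U :: real ^ 'm::finite ^ 'd. U ** transpose U \<noteq> 0 \<longrightarrow>
          I_ratio \<mu> (U ** transpose U) =
            (\<integral>\<omega>. (norm (transpose U ** task_proj (T t \<omega>) ** U))\<^sup>2 \<partial>M)
              / (norm (U ** transpose U))\<^sup>2)
    \<and> (\<forall>(E :: (real ^ 'd) set) m. subspace E \<and> dim E = m \<and> m \<ge> 1 \<longrightarrow>
          I_ratio \<mu> (orth_proj_mat E) =
            (1 / real m) *
              (\<integral>\<omega>. (norm (orth_proj_mat E ** task_proj (T t \<omega>) ** orth_proj_mat E))\<^sup>2 \<partial>M)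
          \<and> (1 / real m) *
              (\<integral>\<omega>. (norm (orth_proj_mat E ** task_proj (T t \<omega>) ** orth_proj_mat E))\<^sup>2 \<partial>M)
            = (1 / real m) *
              (\<integral>\<omega>. (\<Sum>j=1..m. cos (principal_angle E (task_null (T t \<omega>)) j) ^ 4) \<partial>M))"
proof (intro conjI ballI impI allI)
  note \<mu> = assms(1)
  fix A :: "real ^ 'd ^ 'd" assume A: "A \<in> sym_mats" "A \<noteq> 0"
  show "0 \<le> I_ratio \<mu> A"
    unfolding I_ratio_def by simp
  show "I_ratio \<mu> A \<le> 1"
    by (rule I_ratio_le_1[OF \<mu> A(2)])
  show "I_ratio \<mu> A \<le> rho \<mu>"
    by (rule I_ratio_max(2)[OF \<mu> A])
next
  show "\<exists>A\<in>sym_mats. A \<noteq> 0 \<and> I_ratio \<mu> A = rho \<mu>"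
    by (rule I_ratio_max(1)[OF assms(1)])
next
  fix U :: "real ^ 'm ^ 'd"
  show "I_ratio \<mu> (U ** transpose U) =
      (\<integral>\<omega>. (norm (transpose U ** task_proj (T t \<omega>) ** U))\<^sup>2 \<partial>M) / (norm (U ** transpose U))\<^sup>2"
    unfolding I_ratio_iid[OF assms]
    by (simp only: norm_compression_gram[OF transpose_task_proj task_proj_idem])
next
  fix E :: "(real ^ 'd) set" and m
  assume "subspace E \<and> dim E = m \<and> m \<ge> 1"
  then have E: "subspace E" and m: "m = dim E" by auto
  let ?Q = "orth_proj_mat E"
  \<comment> \<open>U is the square matrix Pi_E instead of a matrix of m basis columns, because m =
    dim E is a number and not an index type.\<close>
  have Q: "?Q ** transpose ?Q = ?Q"
    by (simp add: transpose_orth_proj_mat orth_proj_mat_idem E)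
  have "I_ratio \<mu> (?Q ** transpose ?Q)
      = (\<integral>\<omega>. (norm (transpose ?Q ** task_proj (T t \<omega>) ** ?Q))\<^sup>2 \<partial>M) / (norm (?Q ** transpose ?Q))\<^sup>2"
    unfolding I_ratio_iid[OF assms]
    by (simp only: norm_compression_gram[OF transpose_task_proj task_proj_idem])
  then show "I_ratio \<mu> ?Q = (1 / real m) * (\<integral>\<omega>. (norm (?Q ** task_proj (T t \<omega>) ** ?Q))\<^sup>2 \<partial>M)"
    unfolding Q by (simp add: transpose_orth_proj_mat norm_orth_proj_mat E m)
  show "(1 / real m) * (\<integral>\<omega>. (norm (?Q ** task_proj (T t \<omega>) ** ?Q))\<^sup>2 \<partial>M)
      = (1 / real m) * (\<integral>\<omega>. (\<Sum>j=1..m. cos (principal_angle E (task_null (T t \<omega>)) j) ^ 4) \<partial>M)"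
    unfolding task_proj_eq_orth_proj_mat m
    by (simp only: norm_compression_principal_angles[OF E subspace_task_null])
qed

end
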